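(* Let $(x_k)$, $(g_k)$, $(d_k)$, $(w_k)$, $(\Delta_k)$, $(B_k)$, $(s_k)$ be generated by the ADAGB2 algorithm (defined in the context, with constants $\varsigma,\tau\in(0,1]$ and $\kappa_s\ge 1$) applied to the problem $\min_{x\in\mathcal F} f(x)$, $\mathcal F=\{x\in\mathbb R^n\mid l_i\le x_i\le u_i,\ i=1,\dots,n\}$. Write $G_k=\nabla f(x_k)$ and $\Xi_k=P_{\mathcal F}(x_k-G_k)-x_k$. Suppose that: (1) $f$ is twice continuously differentiable and $\mathcal F\neq\emptyset$; (2) there is $L\ge 0$ such that $\|\nabla f(x)-\nabla f(y)\|\le L\|x-y\|$ for all $x,y\in\mathbb R^n$; (3) there is $\kappa_B\ge 1$ such that $\|B_k\|\le\kappa_B$ for all $k\ge 0$; (4) there is a constant $f_{\rm low}<f(x_0)$ such that $f(x)\ge f_{\rm low}$ for all $x\in\mathcal F$; (5) there is $\kappa_{Gg}>0$ such that $\mathbb E_k\big[|(G_k-g_k)^Ts_k|\big]\le \kappa_{Gg}^2\,\mathbb E_k\big[\|s_k\|^2\big]$ for all $k\ge 0$. Suppose moreover that one of the following two conditions holds, and define $\kappa_1$ accordingly: (a) $\mathbb E[\|\Xi_k\|]\le\kappa_{\rm opt}\,\mathbb E[\|d_k\|]$ for some constant $\kappa_{\rm opt}>0$ and all $k\ge0$, in which case $\kappa_1=\kappa_{\rm opt}$; (b) $\mathbb E_k[\|g_k-G_k\|]\le\kappa_{\rm err1}\,\mathbb E_k[\|d_k\|]$ for some constant $\kappa_{\rm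 err1}>0$ and all $k\ge0$, in which case $\kappa_1=1+\kappa_{\rm err1}$. Then, given $\delta\in(0,1)$ and $\epsilon\in(0,1]$, $$\mathbb P\left[\min_{j\in\{0,\dots,k\}}\|\Xi_j\|\le\epsilon\right]\ge 1-\delta\quad\text{for}\quad k>\left(\frac{\kappa_1\kappa_{\rm conv}}{\delta\,\epsilon}\right)^2,$$ where, with $\Gamma_0=f(x_0)-f_{\rm low}$ and $\kappa_*=\kappa_s^2\left(\kappa_{Gg}^2+\tfrac12(\kappa_B+L)\right)$, $$\kappa_{\rm conv}=\frac{4\kappa_B}{\tau\varsigma^2}\left\{1+\Gamma_0+2n\kappa_*\left[\log\left(\frac{8n\kappa_*\kappa_B}{\tau\varsigma^{5/2}}\right)-1\right]\right\}.$$
   Context: Problem and notation. $\|\cdot\|$ is the Euclidean norm (and the induced matrix norm). $l,u$ are vectors of bounds, with infinite entries allowed ($l_i=-\infty$, $u_i=+\infty$); $f$ is a real-valued function defined on an open set containing $\mathcal F$ (the Lipschitz hypothesis being stated on all of $\mathbb R^n$ presumes $\nabla f$ is defined there). For a nonempty closed box $S$, $P_S$ is the Euclidean projection onto $S$ (computed componentwise). $v_i$ or $v_{k,i}$ is the $i$-th component of $v$ or $v_k$. ADAGB2 algorithm. Inputs: deterministic $x_{\rm ini}\in\mathbb R^n$, $l$, $u$. Constants $\varsigma,\tau\in(0,1]$, $\kappa_s\ge1$. Set $x_0=P_{\mathcal F}(x_{\rm ini})$ and $w_{-1,i}=\sqrt{\varsigma}$ for all $i$. For $k=0,1,2,\dots$: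 Step 1. Obtain $g_k=g(x_k,\xi)$, a random approximation of $G_k=\nabla f(x_k)$ (no unbiasedness is assumed). Set $d_k=P_{\mathcal F}(x_k-g_k)-x_k$ and, for each $i$, $w_{k,i}=\sqrt{w_{k-1,i}^2+d_{k,i}^2}$, $\Delta_{k,i}=|d_{k,i}|/w_{k,i}$. Let $\mathcal B_k=\{x\in\mathbb R^n\mid |x_i-x_{k,i}|\le\Delta_{k,i},\ i=1,\dots,n\}$ and $s_k^L=P_{\mathcal F\cap\mathcal B_k}(x_k-g_k)-x_k$. Step 2. Choose a symmetric matrix $B_k\in\mathbb R^{n\times n}$ (an approximation of $\nabla^2 f(x_k)$; any symmetric matrix, including $0$, is allowed). Set $s_k^Q=\gamma_k s_k^L$, where $\gamma_k=\min\left[1,\frac{-g_k^Ts_k^L}{(s_k^L)^TB_ks_k^L}\right]$ if $(s_k^L)^TB_ks_k^L>0$ and $\gamma_k=1$ otherwise. Select any $s_k$ such that $x_k+s_k\in\mathcal F$, $|s_{k,i}|\le\kappa_s\Delta_{k,i}$ for all $i$, and $g_k^Ts_k+\frac12 s_k^TB_ks_k\le\tau\left(g_k^Ts_k^Q+\frac12(s_k^Q)^TB_ks_k^Q\right)$. Step 3. Set $x_{k+1}=x_k+s_k$. The algorithm generates a random process on a probability space with probability $\mathbb P$. $\mathbb E_k[\cdot]$ denotes expectation conditioned on knowing $g_0,\dots,g_{k-1}$ (the past up to iteration $k$, by which $x_k$ is regarded as determined) and $\mathbb E[\cdot]$ the full expectation. All random quantities are assumed measurable and the expectations well defined; relations between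 conditional expectations hold almost surely. *)

theory Defs
  imports "HOL-Probability.Probability"
begin

definition feasible_set :: "ereal ^ 'n \<Rightarrow> ereal ^ 'n \<Rightarrow> (real ^ 'n) set" where
  "feasible_set l u = {x. \<forall>i. l $ i \<le> ereal (x $ i) \<and> ereal (x $ i) \<le> u $ i}"

definition trust_region :: "real ^ 'n \<Rightarrow> real ^ 'n \<Rightarrow> (real ^ 'n) set" where
  "trust_region x \<Delta> = {y. \<forall>i. \<bar>y $ i - x $ i\<bar> \<le> \<Delta> $ i}"

definition proj_step :: "(real ^ 'n) set \<Rightarrow> real ^ 'n \<Rightarrow> real ^ 'n \<Rightarrow> real ^ 'n" where
  "proj_step S x v = closest_point S (x - v) - x"

definition quad_model :: "real ^ 'n \<Rightarrow> real ^ 'n ^ 'n \<Rightarrow> real ^ 'n \<Rightarrow> real" where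
  "quad_model g B s = g \<bullet> s + 1 / 2 * (s \<bullet> (B *v s))"

definition cauchy_scale :: "real ^ 'n \<Rightarrow> real ^ 'n ^ 'n \<Rightarrow> real ^ 'n \<Rightarrow> real" where
  "cauchy_scale g B s =
     (if s \<bullet> (B *v s) > 0 then min 1 (- (g \<bullet> s) / (s \<bullet> (B *v s))) else 1)"

text \<open>
  The sequences below form one trajectory of ADAGB2, that is, they are the values taken by the
  random sequences at one outcome. The gradient estimates \<open>g\<close>, the matrices \<open>B\<close> and the steps
  \<open>s\<close> are not functions of the rest, because the algorithm leaves their choice open.
  The initial weight, which the algorithm indexes by \<open>-1\<close>, is the case \<open>0\<close> of the
  case distinction, so that \<open>w k\<close> is the weight vector computed at iteration \<open>k\<close>.
\<close>

definition adagb2_run ::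
  "ereal ^ 'n \<Rightarrow> ereal ^ 'n \<Rightarrow> real ^ 'n \<Rightarrow> real \<Rightarrow> real \<Rightarrow> real \<Rightarrow>
   (nat \<Rightarrow> real ^ 'n) \<Rightarrow> (nat \<Rightarrow> real ^ 'n) \<Rightarrow> (nat \<Rightarrow> real ^ 'n) \<Rightarrow> (nat \<Rightarrow> real ^ 'n) \<Rightarrow>
   (nat \<Rightarrow> real ^ 'n) \<Rightarrow> (nat \<Rightarrow> real ^ 'n ^ 'n) \<Rightarrow> (nat \<Rightarrow> real ^ 'n) \<Rightarrow> bool" where
  "adagb2_run l u xini \<sigma> \<tau> \<kappa>s x g d w \<Delta> B s \<longleftrightarrow>
     x 0 = closest_point (feasible_set l u) xini \<and>
     (\<forall>k.
        d k = proj_step (feasible_set l u) (x k) (g k) \<and>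
        (let wprev = (case k of 0 \<Rightarrow> (\<chi> i. sqrt \<sigma>) | Suc j \<Rightarrow> w j)
         in \<forall>i. w k $ i = sqrt ((wprev $ i)\<^sup>2 + (d k $ i)\<^sup>2)) \<and>
        (\<forall>i. \<Delta> k $ i = \<bar>d k $ i\<bar> / w k $ i) \<and>
        transpose (B k) = B k \<and>
        x k + s k \<in> feasible_set l u \<and>
        (\<forall>i. \<bar>s k $ i\<bar> \<le> \<kappa>s * \<Delta> k $ i) \<and>
        (let sL = proj_step (feasible_set l u \<inter> trust_region (x k) (\<Delta> k)) (x k) (g k);
             sQ = cauchy_scale (g k) (B k) sL *\<^sub>R sL
         in quad_model (g k) (B k) (s k) \<le> \<tau> * quad_model (g k) (B k) sQ) \<and>
        x (Suc k) = x k + s k)"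

text \<open>
  For an open set \<open>U\<close>: \<open>f\<close> has a gradient on \<open>U\<close>, and the derivative of the gradient exists and
  is continuous on \<open>U\<close> in the operator norm.
\<close>

definition twice_continuously_differentiable_on ::
  "(real ^ 'n \<Rightarrow> real) \<Rightarrow> (real ^ 'n) set \<Rightarrow> bool" where
  "twice_continuously_differentiable_on f U \<longleftrightarrow>
     (\<exists>(G :: real ^ 'n \<Rightarrow> real ^ 'n) (H :: real ^ 'n \<Rightarrow> (real ^ 'n) \<Rightarrow>\<^sub>L (real ^ 'n)).
        (\<forall>x\<in>U. (GDERIV f x :> G x) \<and> (G has_derivative blinfun_apply (H x)) (at x)) \<and>
        continuous_on U H)"

text \<open>
  The sigma-algebra generated by \<open>g 0, \<dots>, g (k - 1)\<close>; it is trivial for \<open>k = 0\<close>.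
\<close>

definition past_algebra :: "'w measure \<Rightarrow> (nat \<Rightarrow> 'w \<Rightarrow> real ^ 'n) \<Rightarrow> nat \<Rightarrow> 'w measure" where
  "past_algebra M g k =
     sigma (space M) (\<Union>j\<in>{..<k}. {g j -` A \<inter> space M | A. A \<in> sets borel})"

text \<open>
  Every expectation that occurs is that of a nonnegative quantity. Values in
  \<^typ>\<open>ennreal\<close> make it well defined without an integrability assumption, whereas the
  real-valued versions are \<open>0\<close> on functions that are not integrable.
\<close>

abbreviation cond_exp_past ::
  "'w measure \<Rightarrow> (nat \<Rightarrow> 'w \<Rightarrow> real ^ 'n) \<Rightarrow> nat \<Rightarrow> ('w \<Rightarrow> real) \<Rightarrow> 'w \<Rightarrow> ennreal" where
  "cond_exp_past M g k X \<equiv> nn_cond_exp M (past_algebra M g k) (\<lambda>\<omega>. ennreal (X \<omega>))"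

abbreviation full_exp :: "'w measure \<Rightarrow> ('w \<Rightarrow> real) \<Rightarrow> ennreal" where
  "full_exp M X \<equiv> (\<integral>\<^sup>+ \<omega>. ennreal (X \<omega>) \<partial>M)"

end

theory Submission
  imports Defs
begin

text \<open>
  On every outcome the trust-region step lowers \<open>f\<close>, up to the gradient error along the step and
  a multiple of \<open>(norm (s j))\<^sup>2\<close>, by at least \<open>c * (\<Sum>i\<in>UNIV. (d j $ i)\<^sup>2 / w j $ i)\<close> with
  \<open>c = \<tau> * sqrt \<sigma> / (2 * \<kappa>B)\<close> (\<open>f_decrease\<close>). The weights are those of AdaGrad,
  \<open>(w k $ i)\<^sup>2 = \<sigma> + (\<Sum>j\<le>k. (d j $ i)\<^sup>2)\<close>, so two sums telescope: the decreases of the first \<open>k + 1\<close>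
  iterations add up to at least \<open>c\<close> times the growth of the weights (\<open>weight_sum_le_errors\<close>),
  whereas the squared steps, being of the order \<open>(d j $ i / w j $ i)\<^sup>2\<close>, add up to no more than the
  logarithms of the weights (\<open>sum_step_squares_le\<close>).

  In expectation the gradient error is itself controlled by the squared steps, and \<open>f\<close> is bounded
  below on the feasible set. Hence the expected total weight \<open>W = (\<Sum>i\<in>UNIV. w k $ i)\<close> satisfies an
  inequality in which a linear term is bounded by a constant and a logarithm of \<open>W\<close>. Replacing
  the logarithm by a tangent and solving for the expectation yields the bound \<open>\<kappa>conv\<close>, uniformly
  in \<open>k\<close> (\<open>self_bounding_weight\<close>).

  Since \<open>W\<close> dominates the Euclidean norm of all the \<open>d j $ i\<close> with \<open>j \<le> k\<close>, the Cauchy-Schwarz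
  inequality bounds the sum of the norms of the \<open>d j\<close> by \<open>sqrt (k + 1) * W\<close>
  (\<open>sum_norm_d_le\<close>). Either alternative on the gradient estimates transfers this to the \<open>\<Xi> j\<close> with
  the factor \<open>\<kappa>1\<close>; in the second, because projections are nonexpansive. The mean of the
  \<open>k + 1\<close> norms therefore has expectation at most \<open>\<kappa>1 * \<kappa>conv / sqrt (k + 1)\<close>, and Markov's
  inequality for their minimum gives the claim (\<open>prob_Min_le_ge\<close>).
\<close>

section \<open>Smooth functions and quadratic models\<close>

lemma lipschitz_gradient_descent:
  fixes f :: "'a::real_inner \<Rightarrow> real"
  assumes grad: "\<And>y. GDERIV f y :> gradf y"
    and lip: "\<And>y z. norm (gradf y - gradf z) \<le> L * norm (y - z)"
  shows "f (x + s) \<le> f x + gradf x \<bullet> s + L / 2 * (norm s)\<^sup>2"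
proof -
  define \<phi> where "\<phi> t = f (x + t *\<^sub>R s) - t * (gradf x \<bullet> s) - L / 2 * t\<^sup>2 * (norm s)\<^sup>2" for t
  have deriv: "(\<phi> has_real_derivative
      (gradf (x + t *\<^sub>R s) - gradf x) \<bullet> s - L * t * (norm s)\<^sup>2) (at t)" for t
  proof -
    have "((\<lambda>t. f (x + t *\<^sub>R s)) has_derivative (\<lambda>h. (h *\<^sub>R s) \<bullet> gradf (x + t *\<^sub>R s))) (at t)"
      by (rule has_derivative_compose[where f = "\<lambda>t. x + t *\<^sub>R s"])
        (auto intro!: derivative_eq_intros grad[unfolded gderiv_def])
    then have "((\<lambda>t. f (x + t *\<^sub>R s)) has_real_derivative gradf (x + t *\<^sub>R s) \<bullet> s) (at t)"
      unfolding has_field_derivative_def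
      by (rule has_derivative_eq_rhs) (auto simp: inner_commute)
    then show ?thesis
      unfolding \<phi>_def
      by (auto intro!: derivative_eq_intros simp: inner_diff_left algebra_simps)
  qed
  have "\<phi> 1 \<le> \<phi> 0"
  proof (rule DERIV_nonpos_imp_nonincreasing[where f = \<phi> and a = 0 and b = 1])
    fix t :: real
    assume t: "0 \<le> t" "t \<le> 1"
    have "(gradf (x + t *\<^sub>R s) - gradf x) \<bullet> s \<le> norm (gradf (x + t *\<^sub>R s) - gradf x) * norm s"
      by (rule norm_cauchy_schwarz)
    also have "\<dots> \<le> (L * norm (t *\<^sub>R s)) * norm s"
      using lip[of "x + t *\<^sub>R s" x] by (intro mult_right_mono) auto
    also have "\<dots> = L * t * (norm s)\<^sup>2"
      using t by (simp add: power2_eq_square)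
    finally show "\<exists>y. (\<phi> has_real_derivative y) (at t) \<and> y \<le> 0"
      using deriv by (intro exI conjI) auto
  qed simp
  then show ?thesis
    by (simp add: \<phi>_def)
qed

lemma norm_square_vec: "(norm v)\<^sup>2 = (\<Sum>i\<in>UNIV. (v $ i)\<^sup>2)" for v :: "real ^ 'n"
  by (simp add: norm_vec_def L2_set_def sum_nonneg)

lemma quadratic_form_le_onorm:
  fixes B :: "real ^ 'n ^ 'n"
  shows "\<bar>s \<bullet> (B *v s)\<bar> \<le> onorm ((*v) B) * (norm s)\<^sup>2"
proof -
  have "\<bar>s \<bullet> (B *v s)\<bar> \<le> norm s * norm (B *v s)"
    by (rule Cauchy_Schwarz_ineq2)
  also have "\<dots> \<le> norm s * (onorm ((*v) B) * norm s)"
    by (intro mult_left_mono onorm) auto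
  finally show ?thesis
    by (simp add: power2_eq_square mult_ac)
qed

text \<open>
  The Cauchy scale minimises the model along the segment from \<open>0\<close> to \<open>s\<close>. The hypothesis
  \<open>(norm s)\<^sup>2 \<le> - (g \<bullet> s)\<close>, which a projected step satisfies, turns the curvature bound
  \<open>\<kappa> * (norm s)\<^sup>2\<close> into \<open>- \<kappa> * (g \<bullet> s)\<close>; so the scale is at least \<open>1 / \<kappa>\<close>, and half of the
  linear decrease of the scaled step survives.
\<close>

lemma quad_model_cauchy_scale_le:
  fixes B :: "real ^ 'n ^ 'n"
  assumes gs: "(norm s)\<^sup>2 \<le> - (g \<bullet> s)" and B: "onorm ((*v) B) \<le> \<kappa>" and \<kappa>: "1 \<le> \<kappa>"
  shows "quad_model g B (cauchy_scale g B s *\<^sub>R s) \<le> (g \<bullet> s) / (2 * \<kappa>)"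
proof -
  define q b where "q = g \<bullet> s" and "b = s \<bullet> (B *v s)"
  have q: "q \<le> 0"
    using gs by (smt (verit) q_def zero_le_power2)
  have "b \<le> \<kappa> * (norm s)\<^sup>2"
    using quadratic_form_le_onorm[of s B] mult_right_mono[OF B, of "(norm s)\<^sup>2"]
    unfolding b_def by simp
  also have "\<dots> \<le> \<kappa> * (- q)"
    using gs \<kappa> unfolding q_def by (intro mult_left_mono) auto
  finally have b: "b \<le> - \<kappa> * q" by simp
  have model: "quad_model g B (c *\<^sub>R s) = c * q + c\<^sup>2 / 2 * b" for c
    by (simp add: quad_model_def q_def b_def power2_eq_square
        linear_cmul[OF matrix_vector_mul_linear])
  have half: "q / 2 \<le> q / (2 * \<kappa>)"
  proof -
    have "(- q) / (2 * \<kappa>) \<le> (- q) / 2"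
      using q \<kappa> by (intro divide_left_mono) auto
    then show ?thesis by simp
  qed
  consider "b \<le> 0" | "b > 0" "b \<le> - q" | "b > 0" "- q < b"
    by linarith
  then show ?thesis
  proof cases
    case 1
    then have "cauchy_scale g B s = 1"
      by (simp add: cauchy_scale_def b_def)
    then show ?thesis
      using 1 half q model[of 1] by (simp add: q_def)
  next
    case 2
    then have "cauchy_scale g B s = 1"
      by (simp add: cauchy_scale_def b_def q_def min_def field_simps)
    then show ?thesis
      using 2 half q model[of 1] by (simp add: q_def)
  next
    case 3
    then have c: "cauchy_scale g B s = - q / b"
      by (simp add: cauchy_scale_def b_def q_def min_def field_simps)
    have "quad_model g B (cauchy_scale g B s *\<^sub>R s) = q * (- q / b) / 2"
      unfolding model c using 3 by (simp add: power2_eq_square field_simps)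
    also have "\<dots> \<le> q * (1 / \<kappa>) / 2"
    proof (intro divide_right_mono mult_left_mono_neg q)
      show "1 / \<kappa> \<le> - q / b"
        using b 3 \<kappa> by (simp add: field_simps)
    qed simp
    finally show ?thesis by (simp add: q_def)
  qed
qed


section \<open>Projection onto boxes\<close>

lemma closed_feasible_set:
  fixes l u :: "ereal ^ 'n"
  shows "closed (feasible_set l u)"
proof -
  have "feasible_set l u = (\<Inter>i. {x. l $ i \<le> ereal (x $ i)} \<inter> {x. ereal (x $ i) \<le> u $ i})"
    by (auto simp: feasible_set_def)
  moreover have "closed {x::real^'n. l $ i \<le> ereal (x $ i)}" "closed {x::real^'n. ereal (x $ i) \<le> u $ i}" for i
    by (intro closed_Collect_le continuous_intros)+
  ultimately show ?thesis by (auto intro!: closed_INT)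
qed

lemma feasible_set_component_between:
  assumes y: "y \<in> feasible_set l u" and z: "z \<in> feasible_set l u"
    and between: "\<And>i. (y $ i \<le> v $ i \<and> v $ i \<le> z $ i) \<or> (z $ i \<le> v $ i \<and> v $ i \<le> y $ i)"
  shows "v \<in> feasible_set l u"
  unfolding feasible_set_def
proof (intro CollectI allI)
  fix i
  show "l $ i \<le> ereal (v $ i) \<and> ereal (v $ i) \<le> u $ i"
    using y z between[of i] unfolding feasible_set_def
    by (auto intro: order_trans ereal_less_eq(3)[THEN iffD2])
qed

lemma convex_feasible_set:
  fixes l u :: "ereal ^ 'n"
  shows "convex (feasible_set l u)"
  unfolding convex_alt
proof (intro ballI allI impI)
  fix y z :: "real ^ 'n" and t :: real
  assume y: "y \<in> feasible_set l u" and z: "z \<in> feasible_set l u" and t: "0 \<le> t \<and> t \<le> 1"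
  show "(1 - t) *\<^sub>R y + t *\<^sub>R z \<in> feasible_set l u"
  proof (rule feasible_set_component_between[OF y z])
    fix i
    have v: "((1 - t) *\<^sub>R y + t *\<^sub>R z) $ i = y $ i + t * (z $ i - y $ i)"
        "((1 - t) *\<^sub>R y + t *\<^sub>R z) $ i = z $ i - (1 - t) * (z $ i - y $ i)"
      by (simp_all add: algebra_simps)
    show "(y $ i \<le> ((1 - t) *\<^sub>R y + t *\<^sub>R z) $ i \<and> ((1 - t) *\<^sub>R y + t *\<^sub>R z) $ i \<le> z $ i) \<or>
          (z $ i \<le> ((1 - t) *\<^sub>R y + t *\<^sub>R z) $ i \<and> ((1 - t) *\<^sub>R y + t *\<^sub>R z) $ i \<le> y $ i)"
    proof (cases "y $ i \<le> z $ i")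
      case True
      then have "0 \<le> t * (z $ i - y $ i)" "0 \<le> (1 - t) * (z $ i - y $ i)"
        using t by auto
      then show ?thesis
        using v by linarith
    next
      case False
      then have "t * (z $ i - y $ i) \<le> 0" "(1 - t) * (z $ i - y $ i) \<le> 0"
        using t by (auto simp: mult_nonneg_nonpos)
      then show ?thesis
        using v by linarith
    qed
  qed
qed

lemma trust_region_eq_feasible_set:
  "trust_region x \<Delta> = feasible_set (\<chi> i. ereal (x $ i - \<Delta> $ i)) (\<chi> i. ereal (x $ i + \<Delta> $ i))"
  unfolding trust_region_def feasible_set_def by (auto simp: abs_diff_le_iff)

text \<open>
  Moving a single coordinate of the projected point within the set reduces the variational
  inequality of the projection to its term in that coordinate.
\<close>

lemma closest_point_component:
  fixes S :: "(real ^ 'n) set"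
  assumes S: "convex S" "closed S" and z: "z \<in> S"
    and same: "\<And>j. j \<noteq> i \<Longrightarrow> z $ j = closest_point S a $ j"
  shows "(a $ i - closest_point S a $ i) * (z $ i - closest_point S a $ i) \<le> 0"
proof -
  have "(a - closest_point S a) \<bullet> (z - closest_point S a)
      = (\<Sum>j\<in>UNIV. if j = i then (a $ i - closest_point S a $ i) * (z $ i - closest_point S a $ i) else 0)"
    unfolding inner_vec_def by (rule sum.cong) (auto simp: same)
  then show ?thesis
    using closest_point_dot[OF S z, of a] by simp
qed

text \<open>
  One coordinate of the linear step: \<open>d\<close> stands for the projection of \<open>- g\<close> onto an interval that
  contains \<open>0\<close>, and \<open>p\<close> for its projection onto an interval that contains \<open>0\<close> and \<open>m * d\<close>; the
  hypotheses are the corresponding variational inequalities. If \<open>d \<noteq> 0\<close>, then \<open>- g\<close> lies at least as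
  far from \<open>0\<close> as \<open>d\<close> and on the same side, so \<open>p\<close> cannot stop before \<open>m * d\<close>. A comparison
  of function values instead of variational inequalities would lose a factor of two.
\<close>

lemma truncated_projection_decrease:
  fixes g d p m :: real
  assumes d: "(g + d) * d \<le> 0" and p0: "(g + p) * p \<le> 0" and pm: "(g + p) * (p - m * d) \<le> 0"
    and m: "0 \<le> m" "m \<le> 1"
  shows "g * p \<le> - (m * d\<^sup>2)"
proof -
  consider "d = 0" | "d > 0" | "d < 0" by linarith
  then show ?thesis
  proof cases
    case 1
    then show ?thesis
      using p0 zero_le_square[of p] unfolding distrib_right by (simp del: zero_le_square)
  next
    case 2
    then have g: "g \<le> - d"
      using d by (auto simp: mult_le_0_iff)
    have md: "m * d \<le> d"
      using 2 m by (simp add: mult_left_le_one_le)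
    have "m * d \<le> p"
      using pm g md by (auto simp: mult_le_0_iff)
    then have "g * p \<le> g * (m * d)"
      using g 2 by (intro mult_left_mono_neg) auto
    also have "\<dots> \<le> - d * (m * d)"
      using g 2 m by (intro mult_right_mono) auto
    finally show ?thesis by (simp add: power2_eq_square mult_ac)
  next
    case 3
    then have g: "- d \<le> g"
      using d by (auto simp: mult_le_0_iff)
    have md: "d \<le> m * d"
      using mult_left_le_one_le[of "- d" m] 3 m by simp
    have "p \<le> m * d"
      using pm g md by (auto simp: mult_le_0_iff)
    then have "g * p \<le> g * (m * d)"
      using g 3 by (intro mult_left_mono) auto
    also have "\<dots> \<le> - d * (m * d)"
      using g 3 m by (intro mult_right_mono_neg) (auto simp: mult_nonneg_nonpos)
    finally show ?thesis by (simp add: power2_eq_square mult_ac)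
  qed
qed

lemma proj_step_norm_le_inner:
  assumes S: "convex S" "closed S" "x \<in> S"
  shows "(norm (proj_step S x v))\<^sup>2 \<le> - (v \<bullet> proj_step S x v)"
proof -
  define p where "p = closest_point S (x - v)"
  have "(x - v - p) \<bullet> (x - p) \<le> 0"
    unfolding p_def by (rule closest_point_dot[OF S])
  then show ?thesis
    unfolding proj_step_def p_def[symmetric] power2_norm_eq_inner
    by (simp add: algebra_simps inner_commute)
qed

lemma proj_step_nonexpansive:
  assumes "convex S" "closed S" "S \<noteq> {}"
  shows "norm (proj_step S x v - proj_step S x v') \<le> norm (v - v')"
  using closest_point_lipschitz[OF assms, of "x - v" "x - v'"]
  by (simp add: proj_step_def dist_norm norm_minus_commute)

lemma borel_measurable_proj_step:
  assumes S: "convex S" "closed S" "S \<noteq> {}"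
    and [measurable]: "x \<in> borel_measurable M" "v \<in> borel_measurable M"
  shows "(\<lambda>\<omega>. proj_step S (x \<omega>) (v \<omega>)) \<in> borel_measurable M"
proof -
  have [measurable]: "closest_point S \<in> borel_measurable borel"
    by (intro borel_measurable_continuous_onI continuous_on_closest_point S)
  show ?thesis
    unfolding proj_step_def by measurable
qed


section \<open>Trajectories\<close>

text \<open>
  The random sequences at a single outcome. All estimates that hold outcome by outcome are derived
  here; probability enters only when their expectations are taken.
\<close>

locale adagb2_trajectory =
  fixes l u :: "ereal ^ 'n" and xini :: "real ^ 'n" and \<sigma> \<tau> \<kappa>s :: real
    and x g d w \<Delta> s :: "nat \<Rightarrow> real ^ 'n" and B :: "nat \<Rightarrow> real ^ 'n ^ 'n"
  assumes run: "adagb2_run l u xini \<sigma> \<tau> \<kappa>s x g d w \<Delta> B s"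
    and nonempty: "feasible_set l u \<noteq> {}"
    and \<sigma>: "0 < \<sigma>" "\<sigma> \<le> 1" and \<tau>: "0 < \<tau>" and \<kappa>s: "1 \<le> \<kappa>s"
begin

definition prior_weight :: "nat \<Rightarrow> real ^ 'n" where
  "prior_weight j = (case j of 0 \<Rightarrow> (\<chi> i. sqrt \<sigma>) | Suc m \<Rightarrow> w m)"

definition linear_step :: "nat \<Rightarrow> real ^ 'n" where
  "linear_step j = proj_step (feasible_set l u \<inter> trust_region (x j) (\<Delta> j)) (x j) (g j)"

lemma run_unfolded:
  shows x_0: "x 0 = closest_point (feasible_set l u) xini"
    and d_eq: "d j = proj_step (feasible_set l u) (x j) (g j)"
    and w_eq: "w j $ i = sqrt ((prior_weight j $ i)\<^sup>2 + (d j $ i)\<^sup>2)"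
    and \<Delta>_eq: "\<Delta> j $ i = \<bar>d j $ i\<bar> / w j $ i"
    and next_feasible: "x j + s j \<in> feasible_set l u"
    and s_le: "\<bar>s j $ i\<bar> \<le> \<kappa>s * \<Delta> j $ i"
    and model_decrease: "quad_model (g j) (B j) (s j) \<le>
      \<tau> * quad_model (g j) (B j) (cauchy_scale (g j) (B j) (linear_step j) *\<^sub>R linear_step j)"
    and x_Suc: "x (Suc j) = x j + s j"
  using run unfolding adagb2_run_def Let_def prior_weight_def linear_step_def by blast+

lemma prior_weight_Suc: "prior_weight (Suc j) = w j"
  by (simp add: prior_weight_def)

lemma x_feasible: "x j \<in> feasible_set l u"
  by (cases j) (auto simp: x_0 x_Suc next_feasible closest_point_in_set closed_feasible_set nonempty)

lemma weight_eq: "w j $ i = sqrt (\<sigma> + (\<Sum>m\<le>j. (d m $ i)\<^sup>2))"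
proof (induction j)
  case 0
  then show ?case
    using \<sigma> by (simp add: w_eq prior_weight_def)
next
  case (Suc j)
  have "0 \<le> \<sigma> + (\<Sum>m\<le>j. (d m $ i)\<^sup>2)"
    using \<sigma> by (simp add: sum_nonneg add_nonneg_nonneg)
  then show ?case
    using Suc by (simp add: w_eq[of "Suc j"] prior_weight_Suc)
qed

lemma sqrt_le_weight: "sqrt \<sigma> \<le> w j $ i"
  by (simp add: weight_eq sum_nonneg)

lemma weight_pos: "0 < w j $ i"
  using sqrt_le_weight[of j i] \<sigma> by (smt (verit) real_sqrt_gt_zero)

lemma prior_weight_pos: "0 < prior_weight j $ i"
  using \<sigma> weight_pos by (cases j) (simp_all add: prior_weight_def)

lemma weight_square: "(w j $ i)\<^sup>2 = (prior_weight j $ i)\<^sup>2 + (d j $ i)\<^sup>2"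
  by (simp add: w_eq)

lemma abs_d_le_weight: "\<bar>d j $ i\<bar> \<le> w j $ i"
  by (simp add: w_eq real_sqrt_ge_abs2)

lemma radius_le_1: "\<Delta> j $ i \<le> 1"
  using abs_d_le_weight weight_pos by (simp add: \<Delta>_eq)

lemma norm_step_bound: "(norm (s j))\<^sup>2 \<le> real CARD('n) * \<kappa>s\<^sup>2"
proof -
  have "(norm (s j))\<^sup>2 = (\<Sum>i\<in>UNIV. (s j $ i)\<^sup>2)"
    by (rule norm_square_vec)
  also have "\<dots> \<le> (\<Sum>i\<in>(UNIV::'n set). \<kappa>s\<^sup>2)"
  proof (rule sum_mono)
    fix i
    have "\<kappa>s * \<Delta> j $ i \<le> \<kappa>s * 1"
      using \<kappa>s radius_le_1 by (intro mult_left_mono) auto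
    then have "\<bar>s j $ i\<bar> \<le> \<kappa>s"
      using s_le[of j i] by simp
    then show "(s j $ i)\<^sup>2 \<le> \<kappa>s\<^sup>2"
      by (metis abs_ge_zero power2_abs power_mono)
  qed
  finally show ?thesis by simp
qed

text \<open>
  The weights increase by at most \<open>(d j $ i)\<^sup>2 / w j $ i\<close>, so these quotients sum to at least the
  total increase. Divided by \<open>(w j $ i)\<^sup>2\<close> instead, the squares \<open>(d j $ i)\<^sup>2\<close> are relative increments
  of \<open>(w j $ i)\<^sup>2\<close>, which the increments of its logarithm dominate.
\<close>

lemma weight_increase_le: "w j $ i - prior_weight j $ i \<le> (d j $ i)\<^sup>2 / w j $ i"
proof -
  have "(w j $ i - prior_weight j $ i) * w j $ i \<le> (w j $ i - prior_weight j $ i) * (w j $ i + prior_weight j $ i)"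
  proof (rule mult_left_mono)
    show "0 \<le> w j $ i - prior_weight j $ i"
      using prior_weight_pos[of j i] by (simp add: w_eq real_sqrt_ge_abs1 real_le_rsqrt)
  qed (use prior_weight_pos[of j i] in simp)
  also have "\<dots> = (d j $ i)\<^sup>2"
    using weight_square[of j i] by (simp add: power2_eq_square algebra_simps)
  finally show ?thesis
    using weight_pos[of j i] by (simp add: pos_le_divide_eq)
qed

lemma weight_le_sum: "w k $ i - sqrt \<sigma> \<le> (\<Sum>j\<le>k. (d j $ i)\<^sup>2 / w j $ i)"
proof (induction k)
  case 0
  then show ?case
    using weight_increase_le[of 0 i] by (simp add: prior_weight_def)
next
  case (Suc k)
  then show ?case
    using weight_increase_le[of "Suc k" i] by (simp add: prior_weight_Suc)
qed

lemma relative_square_le: "((d j $ i) / w j $ i)\<^sup>2 \<le> 2 * (ln (w j $ i) - ln (prior_weight j $ i))"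
proof -
  let ?r = "prior_weight j $ i / w j $ i"
  have "ln (?r\<^sup>2) \<le> ?r\<^sup>2 - 1"
    using weight_pos[of j i] prior_weight_pos[of j i] by (intro ln_le_minus_one) simp
  also have "\<dots> = - ((d j $ i) / w j $ i)\<^sup>2"
  proof -
    have "(prior_weight j $ i)\<^sup>2 = (w j $ i)\<^sup>2 - (d j $ i)\<^sup>2"
      by (simp add: weight_square)
    then show ?thesis
      using weight_pos[of j i] by (simp add: power_divide diff_divide_distrib)
  qed
  finally show ?thesis
    using weight_pos[of j i] prior_weight_pos[of j i] by (simp add: ln_realpow ln_div)
qed

lemma sum_relative_squares_le:
  "(\<Sum>j\<le>k. ((d j $ i) / w j $ i)\<^sup>2) \<le> 2 * ln (w k $ i / sqrt \<sigma>)"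
proof -
  have "(\<Sum>j\<le>k. ((d j $ i) / w j $ i)\<^sup>2) \<le> 2 * (ln (w k $ i) - ln (sqrt \<sigma>))"
  proof (induction k)
    case 0
    then show ?case
      using relative_square_le[of 0 i] by (simp add: prior_weight_def)
  next
    case (Suc k)
    then show ?case
      using relative_square_le[of "Suc k" i] by (simp add: prior_weight_Suc)
  qed
  then show ?thesis
    using weight_pos[of k i] \<sigma> by (simp add: ln_div)
qed

lemma sum_step_squares_le:
  "(\<Sum>j\<le>k. (norm (s j))\<^sup>2) \<le> 2 * \<kappa>s\<^sup>2 * (\<Sum>i\<in>UNIV. ln (w k $ i / sqrt \<sigma>))"
proof -
  have "(s j $ i)\<^sup>2 \<le> \<kappa>s\<^sup>2 * ((d j $ i) / w j $ i)\<^sup>2" for i j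
  proof -
    have "(s j $ i)\<^sup>2 \<le> (\<kappa>s * \<Delta> j $ i)\<^sup>2"
      using power_mono[OF s_le abs_ge_zero, where n = 2] by simp
    then show ?thesis by (simp add: \<Delta>_eq power_mult_distrib power_divide)
  qed
  then have "(\<Sum>j\<le>k. (norm (s j))\<^sup>2) \<le> (\<Sum>j\<le>k. \<Sum>i\<in>UNIV. \<kappa>s\<^sup>2 * ((d j $ i) / w j $ i)\<^sup>2)"
    by (auto simp: norm_square_vec intro!: sum_mono)
  also have "\<dots> = (\<Sum>i\<in>UNIV. \<Sum>j\<le>k. \<kappa>s\<^sup>2 * ((d j $ i) / w j $ i)\<^sup>2)"
    by (rule sum.swap)
  also have "\<dots> = \<kappa>s\<^sup>2 * (\<Sum>i\<in>UNIV. \<Sum>j\<le>k. ((d j $ i) / w j $ i)\<^sup>2)"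
    by (simp only: sum_distrib_left)
  also have "\<dots> \<le> \<kappa>s\<^sup>2 * (\<Sum>i\<in>UNIV. 2 * ln (w k $ i / sqrt \<sigma>))"
    by (intro mult_left_mono sum_mono sum_relative_squares_le) simp
  finally show ?thesis by (simp add: sum_distrib_left mult_ac)
qed

text \<open>
  The tangent of the logarithm at \<open>a\<close> keeps the bound linear in the weights, so that it
  survives taking expectations.
\<close>

lemma sum_step_squares_le_linear:
  assumes a: "0 < a"
  shows "(\<Sum>j\<le>k. (norm (s j))\<^sup>2)
    \<le> 2 * \<kappa>s\<^sup>2 * ((\<Sum>i\<in>UNIV. w k $ i) / a + real CARD('n) * (ln (a / sqrt \<sigma>) - 1))"
proof -
  have "ln (w k $ i / sqrt \<sigma>) \<le> w k $ i / a + (ln (a / sqrt \<sigma>) - 1)" for i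
    using ln_le_minus_one[of "w k $ i / a"] a weight_pos[of k i] \<sigma> by (simp add: ln_div)
  then have "(\<Sum>i\<in>UNIV. ln (w k $ i / sqrt \<sigma>)) \<le> (\<Sum>i\<in>UNIV. w k $ i / a + (ln (a / sqrt \<sigma>) - 1))"
    by (intro sum_mono)
  also have "\<dots> = (\<Sum>i\<in>UNIV. w k $ i) / a + real CARD('n) * (ln (a / sqrt \<sigma>) - 1)"
    by (simp add: sum.distrib sum_divide_distrib)
  finally show ?thesis
    using sum_step_squares_le[of k] by (meson mult_left_mono order_trans zero_le_mult_iff zero_le_numeral zero_le_power2)
qed

text \<open>
  The Cauchy-Schwarz inequality over the iterations, with the squares collected by the weights.
\<close>

lemma sum_norm_d_le: "(\<Sum>j\<le>k. norm (d j)) \<le> sqrt (real (Suc k)) * (\<Sum>i\<in>UNIV. w k $ i)"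
proof -
  have "(\<Sum>j\<le>k. (norm (d j))\<^sup>2) = (\<Sum>i\<in>UNIV. \<Sum>j\<le>k. (d j $ i)\<^sup>2)"
    unfolding norm_square_vec by (rule sum.swap)
  also have "\<dots> \<le> (\<Sum>i\<in>UNIV. (w k $ i)\<^sup>2)"
    using \<sigma> by (intro sum_mono) (simp add: weight_eq sum_nonneg add_nonneg_nonneg)
  also have "\<dots> \<le> (\<Sum>i\<in>UNIV. w k $ i)\<^sup>2"
  proof -
    have "sqrt (\<Sum>i\<in>UNIV. (w k $ i)\<^sup>2) \<le> (\<Sum>i\<in>UNIV. w k $ i)"
      using L2_set_le_sum[of UNIV "\<lambda>i. w k $ i"] weight_pos unfolding L2_set_def
      by (simp add: less_imp_le)
    then show ?thesis by (rule sqrt_le_D)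
  qed
  finally have sq: "(\<Sum>j\<le>k. (norm (d j))\<^sup>2) \<le> (\<Sum>i\<in>UNIV. w k $ i)\<^sup>2" .
  have "(\<Sum>j\<le>k. norm (d j))\<^sup>2 \<le> (\<Sum>j\<le>k. (norm (d j))\<^sup>2) * real (Suc k)"
    using sum_squared_le_sum_of_squares[of "\<lambda>j. norm (d j)" "{..k}"] by simp
  also have "\<dots> \<le> (\<Sum>i\<in>UNIV. w k $ i)\<^sup>2 * real (Suc k)"
    using sq by (intro mult_right_mono) auto
  also have "\<dots> = (sqrt (real (Suc k)) * (\<Sum>i\<in>UNIV. w k $ i))\<^sup>2"
    by (simp add: power_mult_distrib)
  finally show ?thesis
    by (rule power2_le_imp_le) (simp add: sum_nonneg weight_pos less_imp_le)
qed

lemma linear_step_norm_le: "(norm (linear_step j))\<^sup>2 \<le> - (g j \<bullet> linear_step j)"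
  unfolding linear_step_def
proof (rule proj_step_norm_le_inner)
  show "x j \<in> feasible_set l u \<inter> trust_region (x j) (\<Delta> j)"
    using x_feasible weight_pos by (simp add: trust_region_def \<Delta>_eq less_imp_le)
qed (auto simp: trust_region_eq_feasible_set intro: convex_Int closed_Int convex_feasible_set closed_feasible_set)

text \<open>
  The trust region allows \<open>min 1 (1 / w j $ i)\<close> of the component \<open>d j $ i\<close>, and this fraction is at
  least \<open>sqrt \<sigma> / w j $ i\<close> because \<open>sqrt \<sigma> \<le> 1\<close> and \<open>sqrt \<sigma> \<le> w j $ i\<close>.
\<close>

lemma linear_step_decrease: "g j \<bullet> linear_step j \<le> - sqrt \<sigma> * (\<Sum>i\<in>UNIV. (d j $ i)\<^sup>2 / w j $ i)"
proof -
  define S where "S = feasible_set l u \<inter> trust_region (x j) (\<Delta> j)"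
  have S: "convex S" "closed S"
    unfolding S_def trust_region_eq_feasible_set
    by (auto intro: convex_Int closed_Int convex_feasible_set closed_feasible_set)
  have xS: "x j \<in> S"
    using x_feasible weight_pos by (simp add: S_def trust_region_def \<Delta>_eq less_imp_le)
  have xd: "x j + d j \<in> feasible_set l u"
    by (simp add: d_eq proj_step_def closest_point_in_set closed_feasible_set nonempty)
  have p: "closest_point S (x j - g j) = x j + linear_step j"
    by (simp add: linear_step_def proj_step_def S_def)
  have pS: "x j + linear_step j \<in> S"
    using closest_point_in_set[of S] S xS by (metis empty_iff p)
  have comp: "g j $ i * linear_step j $ i \<le> - (sqrt \<sigma> * ((d j $ i)\<^sup>2 / w j $ i))" for i
  proof -
    define m where "m = sqrt \<sigma> / w j $ i"
    have m: "0 \<le> m" "m \<le> 1" "m \<le> 1 / w j $ i"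
      using \<sigma> weight_pos[of j i] sqrt_le_weight[of j i]
      by (auto simp: m_def divide_right_mono less_imp_le)
    \<comment> \<open>Only the coordinate \<open>i\<close> of the projected point moves, so that the variational inequality decouples.\<close>
    define replace where "replace c = (\<chi> n. if n = i then x j $ i + c else x j $ n + linear_step j $ n)" for c
    have VI: "(g j $ i + linear_step j $ i) * (linear_step j $ i - c) \<le> 0" if "replace c \<in> S" for c
      using closest_point_component[OF S that, where i = i and a = "x j - g j"]
      by (simp add: p replace_def algebra_simps)
    have replaceI: "replace c \<in> S" if "\<bar>c\<bar> \<le> \<Delta> j $ i" "(0 \<le> c \<and> c \<le> d j $ i) \<or> (d j $ i \<le> c \<and> c \<le> 0)" for c
    proof -
      have "l $ i \<le> ereal (x j $ i + c) \<and> ereal (x j $ i + c) \<le> u $ i"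
      proof -
        have x: "l $ i \<le> ereal (x j $ i)" "ereal (x j $ i) \<le> u $ i"
            "l $ i \<le> ereal (x j $ i + d j $ i)" "ereal (x j $ i + d j $ i) \<le> u $ i"
          using xd x_feasible[of j] by (auto simp: feasible_set_def)
        show ?thesis
          using that(2)
        proof
          assume "0 \<le> c \<and> c \<le> d j $ i"
          then show ?thesis
            using order_trans[OF x(1), of "ereal (x j $ i + c)"] order_trans[OF _ x(4), of "ereal (x j $ i + c)"]
            by simp
        next
          assume "d j $ i \<le> c \<and> c \<le> 0"
          then show ?thesis
            using order_trans[OF x(3), of "ereal (x j $ i + c)"] order_trans[OF _ x(2), of "ereal (x j $ i + c)"]
            by simp
        qed
      qed
      then have "replace c \<in> feasible_set l u"
        using pS by (auto simp: S_def feasible_set_def replace_def)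
      moreover have "replace c \<in> trust_region (x j) (\<Delta> j)"
        using pS that(1) by (auto simp: S_def trust_region_def replace_def)
      ultimately show ?thesis by (simp add: S_def)
    qed
    have "(g j $ i + d j $ i) * d j $ i \<le> 0"
    proof -
      have xd': "x j + d j = closest_point (feasible_set l u) (x j - g j)"
        by (simp add: d_eq proj_step_def)
      have "(\<chi> n. if n = i then x j $ i else x j $ n + d j $ n) \<in> feasible_set l u"
        using xd x_feasible[of j] by (auto simp: feasible_set_def)
      from closest_point_component[OF convex_feasible_set closed_feasible_set this,
          where i = i and a = "x j - g j"]
      show ?thesis
        by (simp add: xd'[symmetric] algebra_simps)
    qed
    moreover have "(g j $ i + linear_step j $ i) * linear_step j $ i \<le> 0"
      using VI[OF replaceI[of 0]] weight_pos[of j i] linear[of 0 "d j $ i"]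
      by (simp add: \<Delta>_eq less_imp_le)
    moreover have "(g j $ i + linear_step j $ i) * (linear_step j $ i - m * d j $ i) \<le> 0"
    proof (rule VI, rule replaceI)
      show "\<bar>m * d j $ i\<bar> \<le> \<Delta> j $ i"
        using m mult_right_mono[of m "1 / w j $ i" "\<bar>d j $ i\<bar>"] by (simp add: \<Delta>_eq abs_mult)
      show "0 \<le> m * d j $ i \<and> m * d j $ i \<le> d j $ i \<or> d j $ i \<le> m * d j $ i \<and> m * d j $ i \<le> 0"
        using m mult_left_le_one_le[of "d j $ i" m] mult_left_le_one_le[of "- d j $ i" m]
        by (cases "0 \<le> d j $ i") (simp_all add: mult_nonneg_nonpos)
    qed
    ultimately have "g j $ i * linear_step j $ i \<le> - (m * (d j $ i)\<^sup>2)"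
      using m by (intro truncated_projection_decrease)
    then show ?thesis by (simp add: m_def)
  qed
  have "g j \<bullet> linear_step j = (\<Sum>i\<in>UNIV. g j $ i * linear_step j $ i)"
    by (simp add: inner_vec_def)
  also have "\<dots> \<le> (\<Sum>i\<in>UNIV. - (sqrt \<sigma> * ((d j $ i)\<^sup>2 / w j $ i)))"
    by (intro sum_mono comp)
  finally show ?thesis
    by (simp add: sum_negf sum_distrib_left)
qed

text \<open>
  Each iteration lowers \<open>f\<close> by a fraction of the linear decrease, up to the gradient error along
  the step and a multiple of \<open>(norm (s j))\<^sup>2\<close> that absorbs the curvature of model and function.
\<close>

lemma f_decrease:
  assumes grad: "\<And>y. GDERIV f y :> gradf y"
    and lip: "\<And>y z. norm (gradf y - gradf z) \<le> L * norm (y - z)"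
    and \<kappa>B: "1 \<le> \<kappa>B" "onorm ((*v) (B j)) \<le> \<kappa>B"
  shows "f (x (Suc j)) + \<tau> * sqrt \<sigma> / (2 * \<kappa>B) * (\<Sum>i\<in>UNIV. (d j $ i)\<^sup>2 / w j $ i)
    \<le> f (x j) + \<bar>(gradf (x j) - g j) \<bullet> s j\<bar> + (\<kappa>B + L) / 2 * (norm (s j))\<^sup>2"
proof -
  let ?D = "\<Sum>i\<in>UNIV. (d j $ i)\<^sup>2 / w j $ i"
  have "quad_model (g j) (B j) (s j) \<le> \<tau> * ((g j \<bullet> linear_step j) / (2 * \<kappa>B))"
    using model_decrease[of j] quad_model_cauchy_scale_le[OF linear_step_norm_le \<kappa>B(2,1)] \<tau>
    by (meson less_imp_le mult_left_mono order_trans)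
  also have "\<dots> \<le> \<tau> * ((- sqrt \<sigma> * ?D) / (2 * \<kappa>B))"
    using linear_step_decrease \<tau> \<kappa>B by (intro mult_left_mono divide_right_mono) auto
  finally have model: "g j \<bullet> s j + s j \<bullet> (B j *v s j) / 2 \<le> - (\<tau> * sqrt \<sigma> / (2 * \<kappa>B) * ?D)"
    by (simp add: quad_model_def)
  have curvature: "- (s j \<bullet> (B j *v s j)) \<le> \<kappa>B * (norm (s j))\<^sup>2"
    using quadratic_form_le_onorm[of "s j" "B j"] mult_right_mono[OF \<kappa>B(2), of "(norm (s j))\<^sup>2"]
    by simp
  have "f (x (Suc j)) \<le> f (x j) + gradf (x j) \<bullet> s j + L / 2 * (norm (s j))\<^sup>2"
    unfolding x_Suc by (rule lipschitz_gradient_descent[OF grad lip])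
  moreover have "gradf (x j) \<bullet> s j \<le> g j \<bullet> s j + \<bar>(gradf (x j) - g j) \<bullet> s j\<bar>"
    by (simp add: inner_diff_left)
  ultimately show ?thesis
    using model curvature by (simp add: field_simps)
qed

lemma weight_sum_le_errors:
  assumes grad: "\<And>y. GDERIV f y :> gradf y"
    and lip: "\<And>y z. norm (gradf y - gradf z) \<le> L * norm (y - z)"
    and \<kappa>B: "1 \<le> \<kappa>B" "\<And>j. onorm ((*v) (B j)) \<le> \<kappa>B"
    and low: "\<And>y. y \<in> feasible_set l u \<Longrightarrow> flow \<le> f y"
  shows "\<tau> * sqrt \<sigma> / (2 * \<kappa>B) * ((\<Sum>i\<in>UNIV. w k $ i) - real CARD('n) * sqrt \<sigma>)
    \<le> f (x 0) - flow + (\<Sum>j\<le>k. \<bar>(gradf (x j) - g j) \<bullet> s j\<bar> + (\<kappa>B + L) / 2 * (norm (s j))\<^sup>2)"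
proof -
  let ?c = "\<tau> * sqrt \<sigma> / (2 * \<kappa>B)"
  let ?E = "\<lambda>j. \<bar>(gradf (x j) - g j) \<bullet> s j\<bar> + (\<kappa>B + L) / 2 * (norm (s j))\<^sup>2"
  let ?D = "\<lambda>j. \<Sum>i\<in>UNIV. (d j $ i)\<^sup>2 / w j $ i"
  have "(\<Sum>i\<in>UNIV. w k $ i) - real CARD('n) * sqrt \<sigma> = (\<Sum>i\<in>UNIV. w k $ i - sqrt \<sigma>)"
    by (simp add: sum_subtractf)
  also have "\<dots> \<le> (\<Sum>i\<in>UNIV. \<Sum>j\<le>k. (d j $ i)\<^sup>2 / w j $ i)"
    by (intro sum_mono weight_le_sum)
  also have "\<dots> = (\<Sum>j\<le>k. ?D j)"
    by (rule sum.swap)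
  finally have "?c * ((\<Sum>i\<in>UNIV. w k $ i) - real CARD('n) * sqrt \<sigma>) \<le> ?c * (\<Sum>j\<le>k. ?D j)"
    using \<tau> \<sigma> \<kappa>B by (intro mult_left_mono) auto
  also have "f (x (Suc k)) + ?c * (\<Sum>j\<le>k. ?D j) \<le> f (x 0) + (\<Sum>j\<le>k. ?E j)"
  proof (induction k)
    case 0
    then show ?case
      using f_decrease[OF grad lip \<kappa>B, of 0] by simp
  next
    case (Suc k)
    then show ?case
      using f_decrease[OF grad lip \<kappa>B, of "Suc k"] by (simp add: distrib_left)
  qed
  then have "?c * (\<Sum>j\<le>k. ?D j) \<le> f (x 0) - flow + (\<Sum>j\<le>k. ?E j)"
    using low[OF x_feasible, of "Suc k"] by linarith
  finally show ?thesis .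
qed

end


section \<open>Expectations\<close>

text \<open>
  With \<open>c = \<tau> * sqrt \<sigma> / (2 * \<kappa>B)\<close> the tangent point \<open>a = 4 * \<kappa>star / c\<close> makes the error terms
  use up exactly half of the factor \<open>c\<close> of \<open>W\<close>, which leaves \<open>c / 2 * W\<close> on the left. The term
  \<open>n * c * sqrt \<sigma>\<close> is at most \<open>n / 2\<close> and is paid for by the \<open>1\<close> and by the
  additional factor \<open>n\<close> inside the final logarithm, since \<open>n - 1 \<le> n * ln n\<close> and \<open>1 \<le> 2 * \<kappa>star\<close>.
  Enlarging the outer factor from \<open>4 * \<kappa>B / (\<tau> * sqrt \<sigma>)\<close> to \<open>4 * \<kappa>B / (\<tau> * \<sigma>\<^sup>2)\<close> requires that the
  bracket be nonnegative, which holds because the logarithm is taken of a number that is at least \<open>4\<close>.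
\<close>

lemma self_bounding_weight:
  fixes W \<Gamma> n :: real
  assumes \<sigma>: "0 < \<sigma>" "\<sigma> \<le> 1" and \<tau>: "0 < \<tau>" "\<tau> \<le> 1" and \<kappa>B: "1 \<le> \<kappa>B" and \<kappa>star: "1 / 2 \<le> \<kappa>star"
    and n: "1 \<le> n" and \<Gamma>: "0 \<le> \<Gamma>"
    and c: "c = \<tau> * sqrt \<sigma> / (2 * \<kappa>B)" and a: "a = 4 * \<kappa>star / c"
    and bound: "c * (W - n * sqrt \<sigma>) \<le> \<Gamma> + 2 * \<kappa>star * (W / a + n * (ln (a / sqrt \<sigma>) - 1))"
  shows "W \<le> 4 * \<kappa>B / (\<tau> * \<sigma>\<^sup>2) *
    (1 + \<Gamma> + 2 * n * \<kappa>star * (ln (8 * n * \<kappa>star * \<kappa>B / (\<tau> * \<sigma> powr (5 / 2))) - 1))"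
proof -
  define A where "A = 8 * \<kappa>star * \<kappa>B / (\<tau> * \<sigma>)"
  define C where "C = 8 * n * \<kappa>star * \<kappa>B / (\<tau> * \<sigma> powr (5 / 2))"
  define K where "K = 1 + \<Gamma> + 2 * n * \<kappa>star * (ln C - 1)"
  have pos: "0 < c" "0 < a" "0 < A" "0 < \<sigma> powr (5/2)"
    using \<sigma> \<tau> \<kappa>B \<kappa>star by (auto simp: c a A_def)
  have aA: "a / sqrt \<sigma> = A"
    using \<sigma> \<tau> \<kappa>B by (simp add: a c A_def field_simps)
  have half: "2 * \<kappa>star * (W / a) = c / 2 * W"
    using pos \<kappa>star by (simp add: a field_simps)
  have cs: "c * sqrt \<sigma> \<le> 1 / 2"
  proof -
    have "\<tau> * \<sigma> \<le> 1 * \<kappa>B"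
      using \<tau> \<sigma> \<kappa>B mult_mono[of \<tau> 1 \<sigma> \<kappa>B] by simp
    then show ?thesis
      using \<sigma> \<kappa>B by (simp add: c field_simps)
  qed
  have powr_le: "\<sigma> powr (5 / 2) \<le> \<sigma>" "\<sigma> powr (5 / 2) \<le> 1"
    using \<sigma> powr_mono'[of 1 "5/2" \<sigma>] powr_mono'[of 0 "5/2" \<sigma>] by auto
  have "n * A \<le> C"
  proof -
    have "8 * n * \<kappa>star * \<kappa>B / (\<tau> * \<sigma>) \<le> C"
      unfolding C_def
    proof (rule divide_left_mono)
      show "\<tau> * \<sigma> powr (5 / 2) \<le> \<tau> * \<sigma>"
        using powr_le(1) \<tau>(1) by simp
      show "0 \<le> 8 * n * \<kappa>star * \<kappa>B"
        using n \<kappa>star \<kappa>B by simp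
      show "0 < \<tau> * \<sigma> * (\<tau> * \<sigma> powr (5 / 2))"
        using \<tau> \<sigma> pos(4) by simp
    qed
    then show ?thesis by (simp add: A_def mult_ac)
  qed
  then have "ln (n * A) \<le> ln C"
    using n pos(3) by (intro ln_mono) simp_all
  then have lnC: "ln n + ln A \<le> ln C"
    using n pos by (simp add: ln_mult)
  have "n - 1 \<le> n * ln n"
  proof -
    have "ln (1 / n) \<le> 1 / n - 1"
      using n by (intro ln_le_minus_one) simp
    then have "1 - 1 / n \<le> ln n"
      using n by (simp add: ln_div)
    then have "n * (1 - 1 / n) \<le> n * ln n"
      using n by (intro mult_left_mono) auto
    then show ?thesis
      using n by (simp add: right_diff_distrib)
  qed
  also have "\<dots> \<le> 2 * \<kappa>star * (n * ln n)"
    using \<kappa>star n mult_right_mono[of 1 "2 * \<kappa>star" "n * ln n"] by simp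
  finally have lnn: "n - 1 \<le> 2 * n * \<kappa>star * ln n" by (simp add: mult_ac)
  have "4 \<le> C"
  proof -
    have "\<tau> * \<sigma> powr (5 / 2) \<le> 1 * 1"
      using \<tau> powr_le by (intro mult_mono) auto
    moreover have "1 / 2 \<le> n * \<kappa>star" "n * \<kappa>star \<le> n * \<kappa>star * \<kappa>B"
      using n \<kappa>star \<kappa>B mult_mono[of 1 n "1/2" \<kappa>star] mult_left_mono[of 1 \<kappa>B "n * \<kappa>star"] by auto
    ultimately have "4 * (\<tau> * \<sigma> powr (5 / 2)) \<le> 8 * (n * \<kappa>star * \<kappa>B)"
      by linarith
    then have "4 * (\<tau> * \<sigma> powr (5 / 2)) \<le> 8 * n * \<kappa>star * \<kappa>B"
      by (simp only: mult.assoc)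
    then show ?thesis
      using \<tau> pos by (simp add: C_def pos_le_divide_eq)
  qed
  then have "exp 1 \<le> C"
    using exp_le by simp
  then have "1 \<le> ln C"
    using \<open>4 \<le> C\<close> by (simp add: ln_ge_iff)
  then have K: "0 \<le> K"
    using \<Gamma> n \<kappa>star by (simp add: K_def)
  have "c / 2 * W \<le> \<Gamma> + n * (c * sqrt \<sigma>) + 2 * n * \<kappa>star * (ln A - 1)"
    using bound half unfolding aA by (simp add: algebra_simps)
  also have "\<dots> \<le> \<Gamma> + (1 + 2 * n * \<kappa>star * ln n) + 2 * n * \<kappa>star * (ln A - 1)"
  proof -
    have "n * (c * sqrt \<sigma>) \<le> n * (1 / 2)"
      using cs n by (intro mult_left_mono) auto
    then show ?thesis
      using lnn n by linarith
  qed
  also have "\<dots> = 1 + \<Gamma> + 2 * n * \<kappa>star * (ln n + ln A - 1)"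
    by (simp add: algebra_simps)
  also have "\<dots> \<le> K"
    unfolding K_def using lnC n \<kappa>star by (intro add_left_mono mult_left_mono) auto
  finally have "W \<le> 4 * \<kappa>B / (\<tau> * sqrt \<sigma>) * K"
    using \<sigma> \<tau> \<kappa>B by (simp add: c field_simps)
  also have "\<dots> \<le> 4 * \<kappa>B / (\<tau> * \<sigma>\<^sup>2) * K"
  proof -
    have "\<sigma>\<^sup>2 \<le> sqrt \<sigma>"
      using \<sigma> powr_mono'[of "1/2" 2 \<sigma>] by (simp add: powr_half_sqrt)
    then show ?thesis
      using \<sigma> \<tau> \<kappa>B K by (intro mult_right_mono divide_left_mono mult_left_mono) auto
  qed
  finally show ?thesis
    by (simp add: K_def C_def)
qed

lemma subalgebra_past_algebra:
  assumes "\<And>j. g j \<in> borel_measurable M"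
  shows "subalgebra M (past_algebra M g k)"
proof -
  let ?\<A> = "\<Union>j\<in>{..<k}. {g j -` A \<inter> space M | A. A \<in> sets borel}"
  have "?\<A> \<subseteq> sets M"
    using assms by (auto intro: measurable_sets)
  moreover from this have "?\<A> \<subseteq> Pow (space M)"
    using sets.space_closed by blast
  ultimately show ?thesis
    unfolding past_algebra_def subalgebra_def
    by (simp add: space_measure_of_conv sets.sigma_sets_subset)
qed

lemma nn_integral_le_if_cond_exp_le:
  assumes "finite_measure M" "subalgebra M F"
    and [measurable]: "X \<in> borel_measurable M" "Y \<in> borel_measurable M"
    and le: "AE \<omega> in M. nn_cond_exp M F X \<omega> \<le> c * nn_cond_exp M F Y \<omega>"
  shows "(\<integral>\<^sup>+\<omega>. X \<omega> \<partial>M) \<le> c * (\<integral>\<^sup>+\<omega>. Y \<omega> \<partial>M)"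
proof -
  interpret finite_measure M by fact
  interpret finite_measure_subalgebra M F
    by unfold_locales fact
  have total: "(\<integral>\<^sup>+\<omega>. nn_cond_exp M F Z \<omega> \<partial>M) = (\<integral>\<^sup>+\<omega>. Z \<omega> \<partial>M)" if "Z \<in> borel_measurable M" for Z
    using nn_cond_exp_intg[of "\<lambda>_. 1" Z] that by simp
  have "(\<integral>\<^sup>+\<omega>. nn_cond_exp M F X \<omega> \<partial>M) \<le> (\<integral>\<^sup>+\<omega>. c * nn_cond_exp M F Y \<omega> \<partial>M)"
    by (rule nn_integral_mono_AE[OF le])
  also have "\<dots> = c * (\<integral>\<^sup>+\<omega>. nn_cond_exp M F Y \<omega> \<partial>M)"
    by (rule nn_integral_cmult) simp
  finally show ?thesis by (simp add: total)
qed

lemma integrable_if_nn_integral_le: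
  fixes X Y :: "'a \<Rightarrow> real"
  assumes [measurable]: "X \<in> borel_measurable M" and X: "\<And>\<omega>. 0 \<le> X \<omega>"
    and Y: "integrable M Y" "\<And>\<omega>. 0 \<le> Y \<omega>" and c: "0 \<le> c"
    and le: "(\<integral>\<^sup>+\<omega>. ennreal (X \<omega>) \<partial>M) \<le> ennreal c * (\<integral>\<^sup>+\<omega>. ennreal (Y \<omega>) \<partial>M)"
  shows "integrable M X" and "(\<integral>\<omega>. X \<omega> \<partial>M) \<le> c * (\<integral>\<omega>. Y \<omega> \<partial>M)"
proof -
  have le': "(\<integral>\<^sup>+\<omega>. ennreal (X \<omega>) \<partial>M) \<le> ennreal (c * (\<integral>\<omega>. Y \<omega> \<partial>M))"
    using le c Y by (simp add: nn_integral_eq_integral ennreal_mult'' integral_nonneg)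
  then show int: "integrable M X"
    using X by (intro integrableI_nonneg) (auto simp: le_less_trans)
  show "(\<integral>\<omega>. X \<omega> \<partial>M) \<le> c * (\<integral>\<omega>. Y \<omega> \<partial>M)"
    using le' X c Y by (simp add: nn_integral_eq_integral[OF int] integral_nonneg)
qed

text \<open>
  If the minimum exceeds \<open>\<epsilon>\<close>, so does every one of the \<open>k + 1\<close> terms, and Markov's inequality
  applies to their sum.
\<close>

lemma (in prob_space) prob_Min_le_ge:
  fixes X :: "nat \<Rightarrow> 'a \<Rightarrow> real"
  assumes int: "\<And>j. j \<le> k \<Longrightarrow> integrable M (X j)" and nonneg: "\<And>j \<omega>. 0 \<le> X j \<omega>" and \<epsilon>: "0 < \<epsilon>"
    and le: "(\<Sum>j\<le>k. expectation (X j)) \<le> \<delta> * (real (Suc k) * \<epsilon>)"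
  shows "1 - \<delta> \<le> prob {\<omega> \<in> space M. (MIN j\<in>{0..k}. X j \<omega>) \<le> \<epsilon>}"
proof -
  let ?S = "\<lambda>\<omega>. \<Sum>j\<le>k. X j \<omega>"
  have meas: "X j \<in> borel_measurable M" if "j \<le> k" for j
    using int[OF that] by auto
  have good: "{\<omega> \<in> space M. (MIN j\<in>{0..k}. X j \<omega>) \<le> \<epsilon>} = {\<omega> \<in> space M. \<exists>j\<le>k. X j \<omega> \<le> \<epsilon>}"
    by (auto simp: Min_le_iff)
  have "{\<omega> \<in> space M. \<exists>j\<le>k. X j \<omega> \<le> \<epsilon>} = (\<Union>j\<in>{..k}. {\<omega> \<in> space M. X j \<omega> \<le> \<epsilon>})"
    by auto
  also have "\<dots> \<in> events"
    using meas by (intro sets.finite_UN) auto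
  finally have event: "{\<omega> \<in> space M. \<exists>j\<le>k. X j \<omega> \<le> \<epsilon>} \<in> events" .
  have S: "?S \<in> borel_measurable M"
    using meas by (intro borel_measurable_sum) auto
  have "prob (space M - {\<omega> \<in> space M. \<exists>j\<le>k. X j \<omega> \<le> \<epsilon>}) \<le> prob {\<omega> \<in> space M. real (Suc k) * \<epsilon> \<le> ?S \<omega>}"
  proof (rule finite_measure_mono)
    show "space M - {\<omega> \<in> space M. \<exists>j\<le>k. X j \<omega> \<le> \<epsilon>} \<subseteq> {\<omega> \<in> space M. real (Suc k) * \<epsilon> \<le> ?S \<omega>}"
    proof clarsimp
      fix \<omega>
      assume *: "\<forall>j\<le>k. \<not> X j \<omega> \<le> \<epsilon>"
      have "(\<Sum>j\<le>k. \<epsilon>) \<le> ?S \<omega>"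
        using * by (intro sum_mono) (auto simp: not_le less_imp_le)
      then show "(1 + real k) * \<epsilon> \<le> ?S \<omega>" by simp
    qed
    show "{\<omega> \<in> space M. real (Suc k) * \<epsilon> \<le> ?S \<omega>} \<in> events"
      using S by (intro borel_measurable_le) auto
  qed
  also have "\<dots> \<le> expectation ?S / (real (Suc k) * \<epsilon>)"
  proof (rule integral_Markov_inequality_measure[where A = "{}"])
    show "integrable M ?S"
      using int by (intro Bochner_Integration.integrable_sum) auto
    show "AE \<omega> in M. 0 \<le> ?S \<omega>"
      using nonneg by (simp add: sum_nonneg)
  qed (use \<epsilon> in simp_all)
  also have "\<dots> \<le> \<delta>"
  proof -
    have "expectation ?S = (\<Sum>j\<le>k. expectation (X j))"
      using int by (intro Bochner_Integration.integral_sum) auto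
    also have "\<dots> \<le> \<delta> * (real (Suc k) * \<epsilon>)"
      by (rule le)
    finally show ?thesis
      using \<epsilon> by (subst pos_divide_le_eq) auto
  qed
  finally show ?thesis
    unfolding good prob_compl[OF event] by simp
qed


section \<open>Complexity in probability\<close>

theorem corollary4p4:
  fixes M :: "'w measure"
    and l u :: "ereal ^ 'n" and xini :: "real ^ 'n"
    and f :: "real ^ 'n \<Rightarrow> real" and gradf :: "real ^ 'n \<Rightarrow> real ^ 'n" and U :: "(real ^ 'n) set"
    and x g d w \<Delta> s G \<Xi> :: "nat \<Rightarrow> 'w \<Rightarrow> real ^ 'n"
    and B :: "nat \<Rightarrow> 'w \<Rightarrow> real ^ 'n ^ 'n"
    and \<sigma> \<tau> \<kappa>s L \<kappa>B flow \<kappa>Gg \<kappa>1 \<Gamma>0 \<kappa>star \<kappa>conv \<delta> \<epsilon> :: real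
    and k :: nat
  assumes "prob_space M"
    and "0 < \<sigma>" "\<sigma> \<le> 1" "0 < \<tau>" "\<tau> \<le> 1" "1 \<le> \<kappa>s"
    \<comment> \<open>the random process\<close>
    and "\<forall>j. g j \<in> borel_measurable M"
    and "\<forall>j. B j \<in> borel_measurable M"
    and "\<forall>j. s j \<in> borel_measurable M"
    and "\<forall>j. x j \<in> borel_measurable (past_algebra M g j)"
    and "\<forall>\<omega>\<in>space M. adagb2_run l u xini \<sigma> \<tau> \<kappa>s
           (\<lambda>j. x j \<omega>) (\<lambda>j. g j \<omega>) (\<lambda>j. d j \<omega>) (\<lambda>j. w j \<omega>) (\<lambda>j. \<Delta> j \<omega>) (\<lambda>j. B j \<omega>) (\<lambda>j. s j \<omega>)"
    and "\<forall>j. \<forall>\<omega>. G j \<omega> = gradf (x j \<omega>)"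
    and "\<forall>j. \<forall>\<omega>. \<Xi> j \<omega> = proj_step (feasible_set l u) (x j \<omega>) (G j \<omega>)"
    \<comment> \<open>(1)\<close>
    and "feasible_set l u \<noteq> {}"
    and "open U" "feasible_set l u \<subseteq> U" "twice_continuously_differentiable_on f U"
    \<comment> \<open>(2)\<close>
    and "\<forall>y. GDERIV f y :> gradf y"
    and "0 \<le> L" "\<forall>y z. norm (gradf y - gradf z) \<le> L * norm (y - z)"
    \<comment> \<open>(3)\<close>
    and "1 \<le> \<kappa>B" "\<forall>j. \<forall>\<omega>\<in>space M. onorm ((*v) (B j \<omega>)) \<le> \<kappa>B"
    \<comment> \<open>(4)\<close>
    and "flow < f (closest_point (feasible_set l u) xini)" "\<forall>y\<in>feasible_set l u. flow \<le> f y"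
    \<comment> \<open>(5)\<close>
    and "0 < \<kappa>Gg"
    and "\<forall>j. AE \<omega> in M. cond_exp_past M g j (\<lambda>\<omega>. \<bar>(G j \<omega> - g j \<omega>) \<bullet> s j \<omega>\<bar>) \<omega>
                 \<le> ennreal (\<kappa>Gg\<^sup>2) * cond_exp_past M g j (\<lambda>\<omega>. (norm (s j \<omega>))\<^sup>2) \<omega>"
    \<comment> \<open>(a) or (b)\<close>
    and "(\<exists>\<kappa>opt > 0. \<kappa>1 = \<kappa>opt \<and>
            (\<forall>j. full_exp M (\<lambda>\<omega>. norm (\<Xi> j \<omega>)) \<le> ennreal \<kappa>opt * full_exp M (\<lambda>\<omega>. norm (d j \<omega>))))
       \<or> (\<exists>\<kappa>err1 > 0. \<kappa>1 = 1 + \<kappa>err1 \<and>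
            (\<forall>j. AE \<omega> in M. cond_exp_past M g j (\<lambda>\<omega>. norm (g j \<omega> - G j \<omega>)) \<omega>
                 \<le> ennreal \<kappa>err1 * cond_exp_past M g j (\<lambda>\<omega>. norm (d j \<omega>)) \<omega>))"
    \<comment> \<open>constants\<close>
    and "\<Gamma>0 = f (closest_point (feasible_set l u) xini) - flow"
    and "\<kappa>star = \<kappa>s\<^sup>2 * (\<kappa>Gg\<^sup>2 + 1 / 2 * (\<kappa>B + L))"
    and "\<kappa>conv = 4 * \<kappa>B / (\<tau> * \<sigma>\<^sup>2) *
           (1 + \<Gamma>0 + 2 * real CARD('n) * \<kappa>star *
              (ln (8 * real CARD('n) * \<kappa>star * \<kappa>B / (\<tau> * \<sigma> powr (5 / 2))) - 1))"
    and "0 < \<delta>" "\<delta> < 1" "0 < \<epsilon>" "\<epsilon> \<le> 1"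
    and "real k > (\<kappa>1 * \<kappa>conv / (\<delta> * \<epsilon>))\<^sup>2"
  shows "measure M {\<omega> \<in> space M. (MIN j\<in>{0..k}. norm (\<Xi> j \<omega>)) \<le> \<epsilon>} \<ge> 1 - \<delta>"
proof -
  interpret prob_space M by fact
  let ?F = "feasible_set l u"
  note params = assms(2-6) and meas_g = assms(7)[rule_format]
    and meas_s = assms(9)[rule_format] and meas_x = assms(10)[rule_format]
    and run = assms(11)[rule_format] and G_eq = assms(12)[rule_format] and \<Xi>_eq = assms(13)[rule_format]
    and nonempty = assms(14) and grad = assms(18)[rule_format]
    and L = assms(19) and lip = assms(20)[rule_format] and \<kappa>B = assms(21) assms(22)[rule_format]
    and low = assms(23) assms(24)[rule_format] and \<kappa>Gg = assms(25) and error = assms(26)[rule_format]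
    and optimality = assms(27) and \<Gamma>0 = assms(28) and \<kappa>star = assms(29) and \<kappa>conv = assms(30)
    and \<delta> = assms(31,32) and \<epsilon> = assms(33) and k = assms(35)
  have trajectory: "adagb2_trajectory l u xini \<sigma> \<tau> \<kappa>s (\<lambda>j. x j \<omega>) (\<lambda>j. g j \<omega>) (\<lambda>j. d j \<omega>)
      (\<lambda>j. w j \<omega>) (\<lambda>j. \<Delta> j \<omega>) (\<lambda>j. s j \<omega>) (\<lambda>j. B j \<omega>)" if "\<omega> \<in> space M" for \<omega>
    using run[OF that] nonempty params by unfold_locales
  have F: "convex ?F" "closed ?F" "?F \<noteq> {}"
    using convex_feasible_set closed_feasible_set nonempty by auto

  have subalg: "subalgebra M (past_algebra M g j)" for j
    using meas_g by (rule subalgebra_past_algebra)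
  note [measurable] = meas_g meas_s
  have [measurable]: "x j \<in> borel_measurable M" for j
    by (rule measurable_from_subalg[OF subalg meas_x])
  have [measurable]: "gradf \<in> borel_measurable borel"
  proof (intro borel_measurable_continuous_onI lipschitz_on_continuous_on)
    show "L-lipschitz_on UNIV gradf"
      using lip L by (auto simp: lipschitz_on_def dist_norm)
  qed
  have [measurable]: "G j \<in> borel_measurable M" for j
    unfolding G_eq[abs_def] by measurable
  have [measurable]: "\<Xi> j \<in> borel_measurable M" for j
    unfolding \<Xi>_eq[abs_def] by (intro borel_measurable_proj_step F) measurable
  have d_eq: "d j \<omega> = proj_step ?F (x j \<omega>) (g j \<omega>)" if "\<omega> \<in> space M" for j \<omega>
    by (rule adagb2_trajectory.d_eq[OF trajectory[OF that]])
  have [measurable]: "d j \<in> borel_measurable M" for j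
    using borel_measurable_proj_step[OF F, of "x j" M "g j"] d_eq
    by (simp cong: measurable_cong)
  have [measurable]: "(\<lambda>\<omega>. d j \<omega> $ i) \<in> borel_measurable M" for j i
    by (rule measurable_compose[of "d j" M borel "\<lambda>v. v $ i"])
      (auto intro!: borel_measurable_continuous_onI continuous_intros)
  define W where "W \<omega> = (\<Sum>i\<in>UNIV. w k \<omega> $ i)" for \<omega>
  have "(\<lambda>\<omega>. \<Sum>i\<in>UNIV. sqrt (\<sigma> + (\<Sum>m\<le>k. (d m \<omega> $ i)\<^sup>2))) \<in> borel_measurable M"
    by measurable
  then have [measurable]: "W \<in> borel_measurable M"
    by (rule measurable_cong[THEN iffD1, rotated])
      (simp add: W_def adagb2_trajectory.weight_eq[OF trajectory])
  have W_nonneg: "0 \<le> W \<omega>" if "\<omega> \<in> space M" for \<omega>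
    unfolding W_def by (intro sum_nonneg less_imp_le adagb2_trajectory.weight_pos[OF trajectory[OF that]])

  \<comment> \<open>The steps are bounded by the radii, so their squares are integrable. The error condition then makes
     the gradient errors along the steps integrable too, even if the \<open>g j\<close> themselves are not.\<close>
  have int_s: "integrable M (\<lambda>\<omega>. (norm (s j \<omega>))\<^sup>2)" for j
    using adagb2_trajectory.norm_step_bound[OF trajectory]
    by (intro integrable_const_bound[where B = "real CARD('n) * \<kappa>s\<^sup>2"]) auto
  let ?e = "\<lambda>j \<omega>. \<bar>(G j \<omega> - g j \<omega>) \<bullet> s j \<omega>\<bar>"
  have error_full: "integrable M (?e j)" "expectation (?e j) \<le> \<kappa>Gg\<^sup>2 * expectation (\<lambda>\<omega>. (norm (s j \<omega>))\<^sup>2)" for j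
  proof -
    have "(\<integral>\<^sup>+\<omega>. ennreal (?e j \<omega>) \<partial>M) \<le> ennreal (\<kappa>Gg\<^sup>2) * (\<integral>\<^sup>+\<omega>. ennreal ((norm (s j \<omega>))\<^sup>2) \<partial>M)"
      by (rule nn_integral_le_if_cond_exp_le[OF finite_measure_axioms subalg _ _ error]) measurable
    from integrable_if_nn_integral_le[OF _ _ int_s _ _ this]
    show "integrable M (?e j)" "expectation (?e j) \<le> \<kappa>Gg\<^sup>2 * expectation (\<lambda>\<omega>. (norm (s j \<omega>))\<^sup>2)"
      by auto
  qed

  define c where "c = \<tau> * sqrt \<sigma> / (2 * \<kappa>B)"
  define a where "a = 4 * \<kappa>star / c"
  define h where "h = (\<kappa>B + L) / 2"
  let ?n = "real CARD('n)"
  have \<kappa>star_eq: "\<kappa>star = \<kappa>s\<^sup>2 * (\<kappa>Gg\<^sup>2 + h)"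
    by (simp add: \<kappa>star h_def)
  have \<kappa>star_ge: "1 / 2 \<le> \<kappa>star"
  proof -
    have "1 * (1 / 2) \<le> \<kappa>s\<^sup>2 * (\<kappa>Gg\<^sup>2 + h)"
    proof (rule mult_mono)
      show "1 \<le> \<kappa>s\<^sup>2"
        using params by simp
      have "1 / 2 \<le> h"
        using \<kappa>B(1) L by (simp add: h_def)
      then show "1 / 2 \<le> \<kappa>Gg\<^sup>2 + h"
        by (simp add: add_increasing)
    qed auto
    then show ?thesis by (simp add: \<kappa>star_eq)
  qed
  have c_pos: "0 < c" and a_pos: "0 < a"
    using params \<kappa>B(1) \<kappa>star_ge by (auto simp: c_def a_def)
  let ?err = "\<lambda>\<omega>. \<Gamma>0 + (\<Sum>j\<le>k. ?e j \<omega> + h * (norm (s j \<omega>))\<^sup>2)"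
  have weights: "c * (W \<omega> - ?n * sqrt \<sigma>) \<le> ?err \<omega>" if \<omega>: "\<omega> \<in> space M" for \<omega>
  proof -
    have "x 0 \<omega> = closest_point ?F xini"
      by (rule adagb2_trajectory.x_0[OF trajectory[OF \<omega>]])
    then show ?thesis
      using adagb2_trajectory.weight_sum_le_errors[OF trajectory[OF \<omega>], where f = f and gradf = gradf
          and L = L and \<kappa>B = \<kappa>B and flow = flow and k = k] grad lip \<kappa>B(1) \<kappa>B(2)[OF \<omega>] low(2)
      by (simp add: c_def W_def \<Gamma>0 h_def G_eq)
  qed
  have int_err: "integrable M ?err"
    using error_full(1) int_s by auto
  \<comment> \<open>The errors dominate \<open>W\<close>, so its expectation is finite and an inequality can be solved for it.\<close>
  have int_W: "integrable M W"
  proof (rule Bochner_Integration.integrable_bound)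
    show "integrable M (\<lambda>\<omega>. ?err \<omega> / c + ?n * sqrt \<sigma>)"
      using int_err by auto
    show "AE \<omega> in M. norm (W \<omega>) \<le> norm (?err \<omega> / c + ?n * sqrt \<sigma>)"
    proof (rule AE_I2)
      fix \<omega>
      assume \<omega>: "\<omega> \<in> space M"
      have "W \<omega> \<le> ?err \<omega> / c + ?n * sqrt \<sigma>"
        using weights[OF \<omega>] c_pos by (simp add: field_simps)
      then show "norm (W \<omega>) \<le> norm (?err \<omega> / c + ?n * sqrt \<sigma>)"
        using W_nonneg[OF \<omega>] by simp
    qed
  qed measurable

  let ?steps = "\<Sum>j\<le>k. expectation (\<lambda>\<omega>. (norm (s j \<omega>))\<^sup>2)"
  have "?steps = expectation (\<lambda>\<omega>. \<Sum>j\<le>k. (norm (s j \<omega>))\<^sup>2)"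
    using int_s by simp
  also have "\<dots> \<le> expectation (\<lambda>\<omega>. 2 * \<kappa>s\<^sup>2 * (W \<omega> / a + ?n * (ln (a / sqrt \<sigma>) - 1)))"
  proof (rule integral_mono)
    show "integrable M (\<lambda>\<omega>. 2 * \<kappa>s\<^sup>2 * (W \<omega> / a + ?n * (ln (a / sqrt \<sigma>) - 1)))"
      using int_W by (intro integrable_mult_right Bochner_Integration.integrable_add integrable_divide) auto
    show "(\<Sum>j\<le>k. (norm (s j \<omega>))\<^sup>2) \<le> 2 * \<kappa>s\<^sup>2 * (W \<omega> / a + ?n * (ln (a / sqrt \<sigma>) - 1))"
      if "\<omega> \<in> space M" for \<omega>
      unfolding W_def
      by (rule adagb2_trajectory.sum_step_squares_le_linear[OF trajectory[OF that] a_pos])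
  qed (use int_s in auto)
  also have "\<dots> = 2 * \<kappa>s\<^sup>2 * (expectation W / a + ?n * (ln (a / sqrt \<sigma>) - 1))"
    using int_W by (simp add: prob_space)
  finally have steps: "?steps \<le> 2 * \<kappa>s\<^sup>2 * (expectation W / a + ?n * (ln (a / sqrt \<sigma>) - 1))" .
  have "c * (expectation W - ?n * sqrt \<sigma>) = expectation (\<lambda>\<omega>. c * (W \<omega> - ?n * sqrt \<sigma>))"
    using int_W by (simp add: prob_space)
  also have "\<dots> \<le> expectation ?err"
    using int_W int_err weights by (intro integral_mono) auto
  also have "\<dots> = \<Gamma>0 + (\<Sum>j\<le>k. expectation (?e j) + h * expectation (\<lambda>\<omega>. (norm (s j \<omega>))\<^sup>2))"
    using error_full(1) int_s by (simp add: prob_space)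
  also have "\<dots> \<le> \<Gamma>0 + (\<Sum>j\<le>k. (\<kappa>Gg\<^sup>2 + h) * expectation (\<lambda>\<omega>. (norm (s j \<omega>))\<^sup>2))"
    using error_full(2) by (intro add_left_mono sum_mono) (simp add: distrib_right)
  also have "\<dots> = \<Gamma>0 + (\<kappa>Gg\<^sup>2 + h) * ?steps"
    by (simp add: sum_distrib_left)
  also have "\<dots> \<le> \<Gamma>0 + (\<kappa>Gg\<^sup>2 + h) * (2 * \<kappa>s\<^sup>2 * (expectation W / a + ?n * (ln (a / sqrt \<sigma>) - 1)))"
    using \<kappa>B(1) L by (intro add_left_mono mult_left_mono steps) (simp add: h_def)
  also have "\<dots> = \<Gamma>0 + 2 * \<kappa>star * (expectation W / a + ?n * (ln (a / sqrt \<sigma>) - 1))"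
    by (simp add: \<kappa>star_eq mult_ac)
  finally have "expectation W \<le> \<kappa>conv"
    unfolding \<kappa>conv using params \<kappa>B(1) \<kappa>star_ge low(1)
    by (intro self_bounding_weight[OF _ _ _ _ _ _ _ _ c_def a_def]) (auto simp: \<Gamma>0)

  have sum_d: "(\<Sum>j\<le>k. norm (d j \<omega>)) \<le> sqrt (real (Suc k)) * W \<omega>" if "\<omega> \<in> space M" for \<omega>
    unfolding W_def by (rule adagb2_trajectory.sum_norm_d_le[OF trajectory[OF that]])
  have int_d: "integrable M (\<lambda>\<omega>. norm (d j \<omega>))" if j: "j \<le> k" for j
  proof (rule Bochner_Integration.integrable_bound)
    show "integrable M (\<lambda>\<omega>. sqrt (real (Suc k)) * W \<omega>)"
      using int_W by simp
    show "AE \<omega> in M. norm (norm (d j \<omega>)) \<le> norm (sqrt (real (Suc k)) * W \<omega>)"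
    proof (rule AE_I2)
      fix \<omega>
      assume \<omega>: "\<omega> \<in> space M"
      have "norm (d j \<omega>) \<le> (\<Sum>j\<le>k. norm (d j \<omega>))"
        using j by (intro member_le_sum) auto
      then show "norm (norm (d j \<omega>)) \<le> norm (sqrt (real (Suc k)) * W \<omega>)"
        using sum_d[OF \<omega>] W_nonneg[OF \<omega>] by simp
    qed
  qed measurable
  obtain \<kappa>1_pos: "0 < \<kappa>1" and \<Xi>_full: "\<And>j. full_exp M (\<lambda>\<omega>. norm (\<Xi> j \<omega>)) \<le> ennreal \<kappa>1 * full_exp M (\<lambda>\<omega>. norm (d j \<omega>))"
    using optimality
  proof (elim disjE exE conjE)
    fix \<kappa>err
    assume \<kappa>err: "0 < \<kappa>err" "\<kappa>1 = 1 + \<kappa>err"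
      and err: "\<forall>j. AE \<omega> in M. cond_exp_past M g j (\<lambda>\<omega>. norm (g j \<omega> - G j \<omega>)) \<omega>
        \<le> ennreal \<kappa>err * cond_exp_past M g j (\<lambda>\<omega>. norm (d j \<omega>)) \<omega>"
    have "full_exp M (\<lambda>\<omega>. norm (\<Xi> j \<omega>)) \<le> ennreal \<kappa>1 * full_exp M (\<lambda>\<omega>. norm (d j \<omega>))" for j
    proof -
      have "full_exp M (\<lambda>\<omega>. norm (g j \<omega> - G j \<omega>)) \<le> ennreal \<kappa>err * full_exp M (\<lambda>\<omega>. norm (d j \<omega>))"
        by (rule nn_integral_le_if_cond_exp_le[OF finite_measure_axioms subalg _ _ err[rule_format]]) measurable
      moreover have "full_exp M (\<lambda>\<omega>. norm (\<Xi> j \<omega>))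
          \<le> (\<integral>\<^sup>+\<omega>. ennreal (norm (d j \<omega>)) + ennreal (norm (g j \<omega> - G j \<omega>)) \<partial>M)"
      proof (rule nn_integral_mono)
        fix \<omega>
        assume "\<omega> \<in> space M"
        then have "norm (\<Xi> j \<omega> - d j \<omega>) \<le> norm (g j \<omega> - G j \<omega>)"
          using proj_step_nonexpansive[OF F] by (simp add: \<Xi>_eq d_eq norm_minus_commute)
        then have "norm (\<Xi> j \<omega>) \<le> norm (d j \<omega>) + norm (g j \<omega> - G j \<omega>)"
          using norm_triangle_sub[of "\<Xi> j \<omega>" "d j \<omega>"] by simp
        then show "ennreal (norm (\<Xi> j \<omega>)) \<le> ennreal (norm (d j \<omega>)) + ennreal (norm (g j \<omega> - G j \<omega>))"
          by (simp add: ennreal_plus[symmetric] del: ennreal_plus)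
      qed
      moreover have "\<dots> = full_exp M (\<lambda>\<omega>. norm (d j \<omega>)) + full_exp M (\<lambda>\<omega>. norm (g j \<omega> - G j \<omega>))"
        by (rule nn_integral_add) measurable
      ultimately have "full_exp M (\<lambda>\<omega>. norm (\<Xi> j \<omega>))
          \<le> full_exp M (\<lambda>\<omega>. norm (d j \<omega>)) + ennreal \<kappa>err * full_exp M (\<lambda>\<omega>. norm (d j \<omega>))"
        using add_left_mono order_trans by fastforce
      then show ?thesis
        using \<kappa>err by (simp add: distrib_right)
    qed
    then show thesis
      using that \<kappa>err by simp
  qed (use that in auto)
  have int_\<Xi>: "integrable M (\<lambda>\<omega>. norm (\<Xi> j \<omega>))"
    and \<Xi>_le: "expectation (\<lambda>\<omega>. norm (\<Xi> j \<omega>)) \<le> \<kappa>1 * expectation (\<lambda>\<omega>. norm (d j \<omega>))" if "j \<le> k" for j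
    using integrable_if_nn_integral_le[OF _ _ int_d[OF that] _ _ \<Xi>_full] \<kappa>1_pos by auto

  let ?N = "real (Suc k)"
  have "(\<Sum>j\<le>k. expectation (\<lambda>\<omega>. norm (\<Xi> j \<omega>))) \<le> (\<Sum>j\<le>k. \<kappa>1 * expectation (\<lambda>\<omega>. norm (d j \<omega>)))"
    using \<Xi>_le by (intro sum_mono) auto
  also have "\<dots> = \<kappa>1 * expectation (\<lambda>\<omega>. \<Sum>j\<le>k. norm (d j \<omega>))"
    using int_d by (simp add: sum_distrib_left)
  also have "\<dots> \<le> \<kappa>1 * expectation (\<lambda>\<omega>. sqrt ?N * W \<omega>)"
    using \<kappa>1_pos int_d int_W sum_d by (intro mult_left_mono integral_mono) auto
  also have "\<dots> = sqrt ?N * (\<kappa>1 * expectation W)"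
    by simp
  also have "\<dots> \<le> sqrt ?N * (\<kappa>1 * \<kappa>conv)"
    using \<kappa>1_pos \<open>expectation W \<le> \<kappa>conv\<close> by (intro mult_left_mono) auto
  also have "\<dots> \<le> sqrt ?N * (sqrt ?N * (\<delta> * \<epsilon>))"
  proof -
    have "(\<kappa>1 * \<kappa>conv / (\<delta> * \<epsilon>))\<^sup>2 \<le> ?N"
      using k by simp
    then have "\<kappa>1 * \<kappa>conv / (\<delta> * \<epsilon>) \<le> sqrt ?N"
      by (rule real_le_rsqrt)
    then show ?thesis
      using \<delta> \<epsilon> by (intro mult_left_mono) (simp_all add: pos_divide_le_eq)
  qed
  also have "\<dots> = \<delta> * (?N * \<epsilon>)"
    unfolding mult.assoc[symmetric] by (simp add: mult.commute[of \<delta>])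
  finally show ?thesis
    using int_\<Xi> \<epsilon> by (intro prob_Min_le_ge) auto
qed

end
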